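(* Let $\mathcal X\subset\mathbb R^m$ be compact, $A\in\mathbb R^{d\times m}$, $b\in\mathbb R^d$, $\alpha>0$, $\beta>0$, and let $g:\mathbb R^d\to\mathbb R$ be convex and differentiable with globally $\frac1\beta$-Lipschitz gradient. Let $\rho,\eta\in\mathcal P(\mathcal X)$ and let $z_\rho,z_\eta$ solve the dual MEM problem with prior $\rho$ and $\eta$, respectively. Then $$\|z_\eta-z_\rho\|\le\frac\alpha\beta\,\kappa'(A,\rho,\eta)\left|\int\exp\langle A^\top z_\eta,u\rangle\,d(\eta-\rho)(u)\right|+\frac\alpha\beta\,\zeta'(A,\rho,\eta)\left\|\int u\exp\langle A^\top z_\eta,u\rangle\,d(\rho-\eta)(u)\right\|.$$
   Context: $\mathcal P(\mathcal X)$ is the set of Borel probability measures on $\mathcal X$. $\|\cdot\|$ is the Euclidean norm on vectors and the operator $2$-norm on matrices. $g^*$ is the Fenchel conjugate of $g$. For measures, $\int f\,d(\eta-\rho):=\int f\,d\eta-\int f\,d\rho$; vector-valued integrals are componentwise. For $\mu\in\mathcal P(\mathcal X)$, $L_\mu(y):=\log\int_{\mathcal X}\exp\langle y,u\rangle\,d\mu(u)$, and the dual MEM problem with prior $\mu$ is to minimize over $z\in\mathbb R^d$ the function $\phi_\mu(z):=\alpha g^*(-z/\alpha)-\langle b,z\rangle+L_\mu(A^\top z)$, which is $\frac\beta\alpha$-strongly convex and has a unique minimizer $z_\mu$. For $\mu\in\mathcal P(\mathcal X)$ and $z\in\mathbb R^d$, $\gamma_{\mu,z}\in\mathcal P(\mathcal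 X)$ is the probability measure with density $\frac{d\gamma_{\mu,z}}{d\mu}(u)=\frac{\exp\langle A^\top z,u\rangle}{\int\exp\langle A^\top z,\cdot\rangle d\mu}$. For a matrix $B$, put $$\zeta(B,\eta,z):=\|B\|\Big(\int\exp\langle A^\top z,\cdot\rangle d\eta\Big)^{-1},\qquad \kappa(B,\rho,\eta,z):=\|\mathbb E_{\gamma_{\rho,z}}[X]\|\,\zeta(B,\eta,z),$$ $$\kappa'(B,\rho,\eta):=\max\{\kappa(B,\rho,\eta,z_\eta),\kappa(B,\eta,\rho,z_\eta)\},\qquad \zeta'(B,\rho,\eta):=\max\{\zeta(B,\rho,z_\eta),\zeta(B,\eta,z_\eta)\}.$$ *)

theory Defs
  imports "HOL-Probability.Probability"
begin

definition borel_probs :: "'a::topological_space set \<Rightarrow> 'a measure set" where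
  "borel_probs X = {\<mu>. prob_space \<mu> \<and> sets \<mu> = sets (restrict_space borel X)}"

(* The conjugate of a finite function may take the value +infinity, hence ereal. *)
definition fenchel_conjugate :: "('a::real_inner \<Rightarrow> real) \<Rightarrow> 'a \<Rightarrow> ereal" where
  "fenchel_conjugate g y = (SUP x. ereal (y \<bullet> x - g x))"

definition log_mgf :: "'a::euclidean_space measure \<Rightarrow> 'a \<Rightarrow> real" where
  "log_mgf \<mu> y = ln (\<integral>u. exp (y \<bullet> u) \<partial>\<mu>)"

definition dual_objective ::
  "real^'m^'d \<Rightarrow> real^'d \<Rightarrow> real \<Rightarrow> (real^'d \<Rightarrow> real) \<Rightarrow> (real^'m) measure \<Rightarrow> real^'d \<Rightarrow> ereal" where
  "dual_objective A b \<alpha> g \<mu> z =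
     ereal \<alpha> * fenchel_conjugate g (- (z /\<^sub>R \<alpha>)) - ereal (b \<bullet> z)
       + ereal (log_mgf \<mu> (transpose A *v z))"

definition solves_dual ::
  "real^'m^'d \<Rightarrow> real^'d \<Rightarrow> real \<Rightarrow> (real^'d \<Rightarrow> real) \<Rightarrow> (real^'m) measure \<Rightarrow> real^'d \<Rightarrow> bool" where
  "solves_dual A b \<alpha> g \<mu> z \<longleftrightarrow> is_arg_min (dual_objective A b \<alpha> g \<mu>) (\<lambda>_. True) z"

definition partition_fun :: "real^'m^'d \<Rightarrow> (real^'m) measure \<Rightarrow> real^'d \<Rightarrow> real" where
  "partition_fun A \<mu> z = (\<integral>u. exp ((transpose A *v z) \<bullet> u) \<partial>\<mu>)"

definition tilted :: "real^'m^'d \<Rightarrow> (real^'m) measure \<Rightarrow> real^'d \<Rightarrow> (real^'m) measure" where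
  "tilted A \<mu> z =
     density \<mu> (\<lambda>u. ennreal (exp ((transpose A *v z) \<bullet> u) / partition_fun A \<mu> z))"

(* onorm of the induced linear map is the operator 2-norm of the matrix. *)
definition zeta :: "real^'m^'d \<Rightarrow> real^'p^'q \<Rightarrow> (real^'m) measure \<Rightarrow> real^'d \<Rightarrow> real" where
  "zeta A B \<eta> z = onorm ((*v) B) * inverse (partition_fun A \<eta> z)"

definition kappa ::
  "real^'m^'d \<Rightarrow> real^'p^'q \<Rightarrow> (real^'m) measure \<Rightarrow> (real^'m) measure \<Rightarrow> real^'d \<Rightarrow> real" where
  "kappa A B \<rho> \<eta> z = norm (\<integral>u. u \<partial>(tilted A \<rho> z)) * zeta A B \<eta> z"

(* In kappa_max and zeta_max the last argument z is meant to be the minimizer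
   of the dual problem with prior \<eta>. *)
definition kappa_max ::
  "real^'m^'d \<Rightarrow> real^'p^'q \<Rightarrow> (real^'m) measure \<Rightarrow> (real^'m) measure \<Rightarrow> real^'d \<Rightarrow> real" where
  "kappa_max A B \<rho> \<eta> z = max (kappa A B \<rho> \<eta> z) (kappa A B \<eta> \<rho> z)"

definition zeta_max ::
  "real^'m^'d \<Rightarrow> real^'p^'q \<Rightarrow> (real^'m) measure \<Rightarrow> (real^'m) measure \<Rightarrow> real^'d \<Rightarrow> real" where
  "zeta_max A B \<rho> \<eta> z = max (zeta A B \<rho> z) (zeta A B \<eta> z)"

definition diff_integral ::
  "'a measure \<Rightarrow> 'a measure \<Rightarrow> ('a \<Rightarrow> 'b::{banach, second_countable_topology}) \<Rightarrow> 'b" where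
  "diff_integral \<mu> \<nu> f = integral\<^sup>L \<mu> f - integral\<^sup>L \<nu> f"

end

theory Submission
  imports Defs
begin

text \<open>
  Write the dual objective with prior \<open>\<mu>\<close> as \<open>h + f\<^sub>\<mu>\<close>, where
  \<open>h z = \<alpha> g*(- z / \<alpha>)\<close> does not depend on the prior and
  \<open>f\<^sub>\<mu> z = - \<langle>b, z\<rangle> + L\<^sub>\<mu> (A\<^sup>T z)\<close> is convex and smooth with gradient
  \<open>A E - b\<close>, \<open>E\<close> being the mean of the tilted measure \<open>\<gamma>\<^bsub>\<mu>,z\<^esub>\<close>.

  The Lipschitz bound on the gradient of \<open>g\<close> makes \<open>h\<close> strongly convex with modulus
  \<open>\<beta> / \<alpha>\<close>, so minimality of \<open>z\<^sub>\<mu>\<close> gives for every \<open>z\<close> in the domain of \<open>h\<close>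
  the variational inequality
  \<open>h z \<ge> h z\<^sub>\<mu> - \<langle>\<nabla>f\<^sub>\<mu> z\<^sub>\<mu>, z - z\<^sub>\<mu>\<rangle> + \<beta>/(2\<alpha>) \<parallel>z - z\<^sub>\<mu>\<parallel>\<^sup>2\<close>
  (lemma \<open>dual_minimizer_variational\<close>).  Adding the inequality for \<open>\<rho>\<close> at \<open>z\<^sub>\<eta>\<close> to the one
  for \<open>\<eta>\<close> at \<open>z\<^sub>\<rho>\<close> eliminates \<open>h\<close> and \<open>b\<close>, and monotonicity of \<open>\<nabla>f\<^sub>\<rho>\<close> moves the base point of
  the \<open>\<rho>\<close>-tilt from \<open>z\<^sub>\<rho>\<close> to \<open>z\<^sub>\<eta>\<close>.  With \<open>D = z\<^sub>\<eta> - z\<^sub>\<rho>\<close> this leaves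
  \<open>\<beta>/\<alpha> \<parallel>D\<parallel>\<^sup>2 \<le> \<langle>A (E\<^sub>\<rho> - E\<^sub>\<eta>), D\<rangle>\<close>, both means being taken at the same point \<open>z\<^sub>\<eta>\<close>.
  It remains to compare two quotients \<open>E\<^sub>\<mu> = N\<^sub>\<mu> / Z\<^sub>\<mu>\<close> with the same integrands:
  \<open>E\<^sub>\<rho> - E\<^sub>\<eta> = (N\<^sub>\<rho> - N\<^sub>\<eta>) / Z\<^sub>\<eta> + (Z\<^sub>\<eta> - Z\<^sub>\<rho>) E\<^sub>\<rho> / Z\<^sub>\<eta>\<close>.

  Derivatives of \<open>L\<^sub>\<mu>\<close> are never formed: the two-sided estimate
  \<open>\<langle>v, E\<rangle> \<le> L\<^sub>\<mu> (y + v) - L\<^sub>\<mu> y \<le> \<langle>v, E\<rangle> + O(\<parallel>v\<parallel>\<^sup>2)\<close> serves instead, and since tilting turns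
  increments of \<open>L\<^sub>\<mu>\<close> into values of \<open>L\<^sub>\<gamma>\<close>, it suffices to prove it for \<open>y = 0\<close>.
\<close>

section \<open>Conjugates of smooth convex functions\<close>

lemma GDERIV_along_line:
  fixes g :: "'a::real_inner \<Rightarrow> real"
  assumes "\<And>x. GDERIV g x :> grad x"
  shows "((\<lambda>t. g (x + t *\<^sub>R v)) has_real_derivative grad (x + t *\<^sub>R v) \<bullet> v) (at t)"
proof -
  have "((\<lambda>t. x + t *\<^sub>R v) has_derivative (\<lambda>s. s *\<^sub>R v)) (at t)"
    by (auto intro!: derivative_eq_intros)
  moreover have "(g has_derivative (\<lambda>h. h \<bullet> grad (x + t *\<^sub>R v))) (at (x + t *\<^sub>R v))"
    using assms by (simp add: gderiv_def)
  ultimately have "((\<lambda>t. g (x + t *\<^sub>R v)) has_derivative (\<lambda>s. (s *\<^sub>R v) \<bullet> grad (x + t *\<^sub>R v))) (at t)"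
    using has_derivative_compose by blast
  then show ?thesis
    by (simp add: has_field_derivative_def inner_commute mult.commute[of _ "_ \<bullet> _"])
qed

text \<open>The difference of both sides, restricted to the segment from \<open>x\<close> to \<open>x + v\<close>, has
  nonpositive derivative by Cauchy-Schwarz and the Lipschitz bound.\<close>

lemma descent_lemma:
  fixes g :: "'a::real_inner \<Rightarrow> real"
  assumes g: "\<And>x. GDERIV g x :> grad x" and L: "L-lipschitz_on UNIV grad"
  shows "g (x + v) \<le> g x + grad x \<bullet> v + L / 2 * (norm v)\<^sup>2"
proof -
  define q where "q t = g (x + t *\<^sub>R v) - t * (grad x \<bullet> v) - L / 2 * t\<^sup>2 * (norm v)\<^sup>2" for t
  have "q 1 \<le> q 0"
  proof (rule DERIV_nonpos_imp_nonincreasing[where f = q])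
    fix t :: real
    assume t: "0 \<le> t" "t \<le> 1"
    have "(q has_real_derivative
        (grad (x + t *\<^sub>R v) \<bullet> v - grad x \<bullet> v - L * t * (norm v)\<^sup>2)) (at t)"
      unfolding q_def
      by (rule derivative_eq_intros GDERIV_along_line[OF g] refl | simp)+
    moreover have "grad (x + t *\<^sub>R v) \<bullet> v - grad x \<bullet> v - L * t * (norm v)\<^sup>2 \<le> 0"
    proof -
      have "(grad (x + t *\<^sub>R v) - grad x) \<bullet> v \<le> norm (grad (x + t *\<^sub>R v) - grad x) * norm v"
        by (rule norm_cauchy_schwarz)
      also have "\<dots> \<le> (L * norm (t *\<^sub>R v)) * norm v"
        using lipschitz_onD[OF L, of "x + t *\<^sub>R v" x]
        by (intro mult_right_mono) (auto simp: dist_norm)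
      also have "\<dots> = L * t * (norm v)\<^sup>2"
        using t by (simp add: power2_eq_square)
      finally show ?thesis by (simp add: inner_diff_left)
    qed
    ultimately show "\<exists>y. (q has_real_derivative y) (at t) \<and> y \<le> 0"
      by blast
  qed simp
  then show ?thesis by (simp add: q_def)
qed

lemma convex_above_gradient:
  fixes g :: "'a::real_inner \<Rightarrow> real"
  assumes conv: "convex_on UNIV g" and g: "\<And>x. GDERIV g x :> grad x"
  shows "g x + grad x \<bullet> v \<le> g (x + v)"
proof -
  let ?q = "\<lambda>t. g (x + t *\<^sub>R v)"
  have "convex_on UNIV ?q"
  proof (rule convex_onI)
    fix t r s :: real
    assume "0 < t" "t < 1"
    then have "g ((1 - t) *\<^sub>R (x + r *\<^sub>R v) + t *\<^sub>R (x + s *\<^sub>R v))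
        \<le> (1 - t) * g (x + r *\<^sub>R v) + t * g (x + s *\<^sub>R v)"
      using convex_onD[OF conv, of t] by simp
    moreover have "(1 - t) *\<^sub>R (x + r *\<^sub>R v) + t *\<^sub>R (x + s *\<^sub>R v)
        = x + ((1 - t) *\<^sub>R r + t *\<^sub>R s) *\<^sub>R v"
      by (simp add: algebra_simps)
    ultimately show "?q ((1 - t) *\<^sub>R r + t *\<^sub>R s) \<le> (1 - t) * ?q r + t * ?q s"
      by simp
  qed simp
  moreover have "(?q has_real_derivative grad x \<bullet> v) (at 0)"
    using GDERIV_along_line[OF g, of x v 0] by simp
  ultimately have "(grad x \<bullet> v) * (1 - 0) \<le> ?q 1 - ?q 0"
    by (intro convex_on_imp_above_tangent[of UNIV]) auto
  then show ?thesis by simp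
qed

lemma fenchel_conjugate_ge: "ereal (y \<bullet> x - g x) \<le> fenchel_conjugate g y"
  unfolding fenchel_conjugate_def by (rule SUP_upper) simp

lemma fenchel_conjugate_not_MInf: "fenchel_conjugate g y \<noteq> -\<infinity>"
  using fenchel_conjugate_ge[of y 0 g] by auto

text \<open>A tangent hyperplane of \<open>g\<close> shows that its slope lies in the domain of the conjugate.\<close>

lemma fenchel_conjugate_grad_finite:
  assumes "convex_on UNIV g" and "\<And>x. GDERIV g x :> grad x"
  shows "fenchel_conjugate g (grad x) \<noteq> \<infinity>"
proof -
  have "fenchel_conjugate g (grad x) \<le> ereal (grad x \<bullet> x - g x)"
    unfolding fenchel_conjugate_def
  proof (rule SUP_least)
    fix y
    show "ereal (grad x \<bullet> y - g y) \<le> ereal (grad x \<bullet> x - g x)"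
      using convex_above_gradient[OF assms, of x "y - x"] by (simp add: inner_diff_right)
  qed
  then show ?thesis by auto
qed

text \<open>
  Strong convexity of the conjugate of an \<open>L\<close>-smooth function, with \<open>L = 1 / \<beta>\<close>.  A lower bound
  for the two conjugate values comes from testing them at points \<open>x + t s\<close> and
  \<open>x - (1 - t) s\<close>, whose weighted mean is \<open>x\<close>; by the descent lemma \<open>g\<close> exceeds its
  linearization at \<open>x\<close> there by a quadratic only, the linear terms cancel, and
  \<open>s = \<beta> (p - q)\<close> maximizes what remains.
\<close>

lemma fenchel_conjugate_strongly_convex:
  fixes g :: "'a::real_inner \<Rightarrow> real"
  assumes g: "\<And>x. GDERIV g x :> grad x" and L: "(1 / \<beta>)-lipschitz_on UNIV grad"
    and "\<beta> > 0" and t: "0 \<le> t" "t \<le> 1"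
    and P: "fenchel_conjugate g p = ereal P" and Q: "fenchel_conjugate g q = ereal Q"
  shows "fenchel_conjugate g ((1 - t) *\<^sub>R p + t *\<^sub>R q)
    \<le> ereal ((1 - t) * P + t * Q - \<beta> / 2 * t * (1 - t) * (norm (p - q))\<^sup>2)"
  unfolding fenchel_conjugate_def
proof (rule SUP_least)
  fix x
  define s where "s = \<beta> *\<^sub>R (p - q)"
  define N where "N = (norm (p - q))\<^sup>2"
  have sN: "(p - q) \<bullet> s = \<beta> * N" "(norm s)\<^sup>2 = \<beta>\<^sup>2 * N"
    by (simp_all add: s_def N_def power2_norm_eq_inner power_mult_distrib)
  have "p \<bullet> (x + t *\<^sub>R s) - g (x + t *\<^sub>R s) \<le> P"
    using fenchel_conjugate_ge[of p "x + t *\<^sub>R s" g] P by simp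
  moreover have "g (x + t *\<^sub>R s) \<le> g x + t * (grad x \<bullet> s) + \<beta> * N / 2 * t\<^sup>2"
    using descent_lemma[OF g L, of x "t *\<^sub>R s"] \<open>\<beta> > 0\<close>
    by (simp add: power_mult_distrib sN) (simp add: power2_eq_square mult_ac)
  ultimately have p: "p \<bullet> x + t * (p \<bullet> s) - g x - t * (grad x \<bullet> s) - \<beta> * N / 2 * t\<^sup>2 \<le> P"
    by (simp add: inner_add_right)
  have "q \<bullet> (x + (t - 1) *\<^sub>R s) - g (x + (t - 1) *\<^sub>R s) \<le> Q"
    using fenchel_conjugate_ge[of q "x + (t - 1) *\<^sub>R s" g] Q by simp
  moreover have "g (x + (t - 1) *\<^sub>R s)
      \<le> g x + (t - 1) * (grad x \<bullet> s) + \<beta> * N / 2 * (t - 1)\<^sup>2"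
    using descent_lemma[OF g L, of x "(t - 1) *\<^sub>R s"] \<open>\<beta> > 0\<close>
    by (simp add: power_mult_distrib sN) (simp add: power2_eq_square mult_ac)
  ultimately have q: "q \<bullet> x + (t - 1) * (q \<bullet> s) - g x - (t - 1) * (grad x \<bullet> s)
      - \<beta> * N / 2 * (t - 1)\<^sup>2 \<le> Q"
    by (simp add: inner_add_right)
  have "(1 - t) * (p \<bullet> x + t * (p \<bullet> s) - g x - t * (grad x \<bullet> s) - \<beta> * N / 2 * t\<^sup>2)
      + t * (q \<bullet> x + (t - 1) * (q \<bullet> s) - g x - (t - 1) * (grad x \<bullet> s) - \<beta> * N / 2 * (t - 1)\<^sup>2)
      \<le> (1 - t) * P + t * Q"
    using t p q by (intro add_mono mult_left_mono) auto
  also have "(1 - t) * (p \<bullet> x + t * (p \<bullet> s) - g x - t * (grad x \<bullet> s) - \<beta> * N / 2 * t\<^sup>2)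
      + t * (q \<bullet> x + (t - 1) * (q \<bullet> s) - g x - (t - 1) * (grad x \<bullet> s) - \<beta> * N / 2 * (t - 1)\<^sup>2)
      = (1 - t) * (p \<bullet> x) + t * (q \<bullet> x) - g x + t * (1 - t) * (p \<bullet> s - q \<bullet> s)
        - \<beta> * N / 2 * (t * (1 - t))"
    by (simp add: power2_eq_square field_simps)
  also have "p \<bullet> s - q \<bullet> s = \<beta> * N"
    using sN by (simp add: inner_diff_left)
  also have "(1 - t) * (p \<bullet> x) + t * (q \<bullet> x) = ((1 - t) *\<^sub>R p + t *\<^sub>R q) \<bullet> x"
    by (simp add: inner_add_left)
  finally show "ereal (((1 - t) *\<^sub>R p + t *\<^sub>R q) \<bullet> x - g x)
      \<le> ereal ((1 - t) * P + t * Q - \<beta> / 2 * t * (1 - t) * (norm (p - q))\<^sup>2)"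
    by (simp add: N_def mult_ac)
qed

section \<open>Cumulant functions on compact sets\<close>

lemma borel_probs_measurable:
  assumes "\<mu> \<in> borel_probs X" and "continuous_on UNIV f"
  shows "f \<in> borel_measurable \<mu>"
proof -
  have "f \<in> borel_measurable (restrict_space borel X)"
    using assms(2) by (intro measurable_restrict_space1 borel_measurable_continuous_onI)
  moreover have "sets \<mu> = sets (restrict_space borel X)"
    using assms(1) by (simp add: borel_probs_def)
  ultimately show ?thesis
    using measurable_cong_sets by blast
qed

lemma borel_probs_space: "\<mu> \<in> borel_probs X \<Longrightarrow> space \<mu> = X"
  using sets_eq_imp_space_eq[of \<mu> "restrict_space borel X"]
  by (simp add: borel_probs_def space_restrict_space)

lemma borel_probs_integrable:
  fixes f :: "'a::topological_space \<Rightarrow> 'b::{banach, second_countable_topology}"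
  assumes \<mu>: "\<mu> \<in> borel_probs X" and "compact X" and f: "continuous_on UNIV f"
  shows "integrable \<mu> f"
proof -
  interpret prob_space \<mu>
    using \<mu> by (simp add: borel_probs_def)
  have "bounded (f ` X)"
    using f \<open>compact X\<close> by (blast intro: compact_imp_bounded compact_continuous_image
        continuous_on_subset)
  then obtain K where "\<And>x. x \<in> X \<Longrightarrow> norm (f x) \<le> K"
    by (auto simp: bounded_iff)
  then show ?thesis
    using borel_probs_measurable[OF \<mu> f] borel_probs_space[OF \<mu>]
    by (intro integrable_const_bound[where B = K]) (auto intro!: AE_I2)
qed

text \<open>Jensen's inequality for the exponential: integrate its tangent line at the mean of
  \<open>\<langle>v, u\<rangle>\<close>.\<close>

lemma log_mgf_ge_mean:
  fixes \<gamma> :: "'a::euclidean_space measure"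
  assumes \<gamma>: "\<gamma> \<in> borel_probs X" and X: "compact X"
  shows "v \<bullet> (\<integral>u. u \<partial>\<gamma>) \<le> log_mgf \<gamma> v" and "0 < (\<integral>u. exp (v \<bullet> u) \<partial>\<gamma>)"
proof -
  interpret prob_space \<gamma>
    using \<gamma> by (simp add: borel_probs_def)
  note int = borel_probs_integrable[OF \<gamma> X]
  define m where "m = v \<bullet> (\<integral>u. u \<partial>\<gamma>)"
  have m: "(\<integral>u. v \<bullet> u \<partial>\<gamma>) = m"
    unfolding m_def by (rule integral_inner_right) (auto intro!: int continuous_intros)
  have "(\<integral>u. exp m * (1 + (v \<bullet> u - m)) \<partial>\<gamma>) \<le> (\<integral>u. exp (v \<bullet> u) \<partial>\<gamma>)"
  proof (rule integral_mono)
    fix u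
    have "exp m * (1 + (v \<bullet> u - m)) \<le> exp m * exp (v \<bullet> u - m)"
      by (intro mult_left_mono exp_ge_add_one_self) auto
    then show "exp m * (1 + (v \<bullet> u - m)) \<le> exp (v \<bullet> u)"
      by (simp flip: exp_add)
  qed (auto intro!: int continuous_intros)
  moreover have "(\<integral>u. exp m * (1 + (v \<bullet> u - m)) \<partial>\<gamma>) = exp m"
  proof -
    have iv: "integrable \<gamma> (\<lambda>u. v \<bullet> u)"
      by (auto intro!: int continuous_intros)
    show ?thesis
      using iv m prob_space by simp
  qed
  ultimately have le: "exp m \<le> (\<integral>u. exp (v \<bullet> u) \<partial>\<gamma>)"
    by simp
  then show pos: "0 < (\<integral>u. exp (v \<bullet> u) \<partial>\<gamma>)"
    using exp_gt_zero[of m] by linarith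
  show "v \<bullet> (\<integral>u. u \<partial>\<gamma>) \<le> log_mgf \<gamma> v"
    using le pos unfolding log_mgf_def m_def[symmetric] by (simp add: ln_ge_iff)
qed

lemma exp_le_quadratic:
  fixes s :: real
  assumes "\<bar>s\<bar> \<le> 1"
  shows "exp s \<le> 1 + s + s\<^sup>2"
proof (cases "0 \<le> s")
  case True
  then show ?thesis
    using assms by (intro exp_bound) auto
next
  case False
  have pos: "0 \<le> 1 + s + s\<^sup>2"
    using assms by (simp add: abs_le_iff add_nonneg_nonneg)
  have "1 \<le> 1 - s ^ 3"
    using False by (simp add: power3_eq_cube mult_nonneg_nonpos)
  also have "\<dots> = (1 + - s) * (1 + s + s\<^sup>2)"
    by (simp add: algebra_simps power2_eq_square power3_eq_cube)
  also have "\<dots> \<le> exp (- s) * (1 + s + s\<^sup>2)"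
    using pos by (intro mult_right_mono exp_ge_add_one_self)
  finally show ?thesis
    by (simp add: exp_minus field_simps)
qed

text \<open>Together with the lower bound by the mean, this says that the cumulant function has the mean as
  its gradient at the origin.  It follows from \<open>ln (1 + s) \<le> s\<close> and, for small \<open>s\<close>,
  \<open>exp s \<le> 1 + s + s\<^sup>2\<close>.\<close>

lemma log_mgf_le_mean_plus_square:
  fixes \<gamma> :: "'a::euclidean_space measure"
  assumes \<gamma>: "\<gamma> \<in> borel_probs X" and X: "compact X"
    and small: "\<And>u. u \<in> X \<Longrightarrow> \<bar>v \<bullet> u\<bar> \<le> r" and r: "r \<le> 1"
  shows "log_mgf \<gamma> v \<le> v \<bullet> (\<integral>u. u \<partial>\<gamma>) + r\<^sup>2"
proof -
  interpret prob_space \<gamma>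
    using \<gamma> by (simp add: borel_probs_def)
  note int = borel_probs_integrable[OF \<gamma> X]
  have m: "(\<integral>u. v \<bullet> u \<partial>\<gamma>) = v \<bullet> (\<integral>u. u \<partial>\<gamma>)"
    by (rule integral_inner_right) (auto intro!: int continuous_intros)
  have iv: "integrable \<gamma> (\<lambda>u. v \<bullet> u)"
    by (auto intro!: int continuous_intros)
  have "(\<integral>u. exp (v \<bullet> u) \<partial>\<gamma>) \<le> (\<integral>u. (1 + r\<^sup>2) + v \<bullet> u \<partial>\<gamma>)"
  proof (rule integral_mono)
    fix u
    assume "u \<in> space \<gamma>"
    then have s: "\<bar>v \<bullet> u\<bar> \<le> r"
      using small borel_probs_space[OF \<gamma>] by simp
    have "exp (v \<bullet> u) \<le> 1 + v \<bullet> u + (v \<bullet> u)\<^sup>2"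
      using s r by (intro exp_le_quadratic) auto
    also have "(v \<bullet> u)\<^sup>2 \<le> r\<^sup>2"
      using s by (simp add: abs_le_square_iff[symmetric])
    finally show "exp (v \<bullet> u) \<le> (1 + r\<^sup>2) + v \<bullet> u"
      by simp
  qed (auto intro!: int continuous_intros)
  also have "\<dots> = 1 + r\<^sup>2 + v \<bullet> (\<integral>u. u \<partial>\<gamma>)"
    using iv m prob_space by simp
  finally have "(\<integral>u. exp (v \<bullet> u) \<partial>\<gamma>) - 1 \<le> v \<bullet> (\<integral>u. u \<partial>\<gamma>) + r\<^sup>2"
    by simp
  moreover have "log_mgf \<gamma> v \<le> (\<integral>u. exp (v \<bullet> u) \<partial>\<gamma>) - 1"
    unfolding log_mgf_def by (intro ln_le_minus_one log_mgf_ge_mean(2)[OF \<gamma> X])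
  ultimately show ?thesis by simp
qed

section \<open>Exponential tilting\<close>

lemma partition_fun_pos:
  assumes "\<mu> \<in> borel_probs X" "compact X"
  shows "0 < partition_fun A \<mu> z"
  unfolding partition_fun_def by (rule log_mgf_ge_mean(2)[OF assms])

lemma integral_tilted:
  fixes f :: "real^'m \<Rightarrow> 'b::{banach, second_countable_topology}"
  assumes \<mu>: "\<mu> \<in> borel_probs X" and X: "compact X" and f: "continuous_on UNIV f"
  shows "(\<integral>u. f u \<partial>tilted A \<mu> z)
    = (\<integral>u. exp ((transpose A *v z) \<bullet> u) *\<^sub>R f u \<partial>\<mu>) /\<^sub>R partition_fun A \<mu> z"
proof -
  have "(\<integral>u. f u \<partial>tilted A \<mu> z)
      = (\<integral>u. (exp ((transpose A *v z) \<bullet> u) / partition_fun A \<mu> z) *\<^sub>R f u \<partial>\<mu>)"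
    unfolding tilted_def using partition_fun_pos[OF \<mu> X, of A z]
    by (intro integral_density borel_probs_measurable[OF \<mu>] f)
      (auto intro!: continuous_intros)
  also have "\<dots> = (\<integral>u. (exp ((transpose A *v z) \<bullet> u) *\<^sub>R f u) /\<^sub>R partition_fun A \<mu> z \<partial>\<mu>)"
    by (simp add: divide_inverse mult.commute)
  finally show ?thesis
    by (simp only: integral_scaleR_right)
qed

lemma tilted_in_borel_probs:
  assumes \<mu>: "\<mu> \<in> borel_probs X" and X: "compact X"
  shows "tilted A \<mu> z \<in> borel_probs X"
proof -
  let ?w = "\<lambda>u. exp ((transpose A *v z) \<bullet> u) / partition_fun A \<mu> z"
  have pos: "0 < partition_fun A \<mu> z"
    by (rule partition_fun_pos[OF \<mu> X])
  have cont: "continuous_on UNIV ?w"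
    using pos by (auto intro!: continuous_intros)
  have "(\<integral>\<^sup>+u. ennreal (?w u) \<partial>\<mu>) = ennreal (\<integral>u. ?w u \<partial>\<mu>)"
    using pos by (intro nn_integral_eq_integral borel_probs_integrable[OF \<mu> X cont]) auto
  also have "(\<integral>u. ?w u \<partial>\<mu>) = 1"
    using pos by (simp add: partition_fun_def)
  finally have "prob_space (density \<mu> (\<lambda>u. ennreal (?w u)))"
    using borel_probs_measurable[OF \<mu> cont]
    by (intro prob_spaceI) (simp add: emeasure_density cong: nn_integral_cong)
  then show ?thesis
    using \<mu> by (simp add: borel_probs_def tilted_def)
qed

lemma log_mgf_shift:
  assumes \<mu>: "\<mu> \<in> borel_probs X" and X: "compact X"
  shows "log_mgf \<mu> (transpose A *v (z + w))
    = log_mgf \<mu> (transpose A *v z) + log_mgf (tilted A \<mu> z) (transpose A *v w)"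
proof -
  have "(\<integral>u. exp ((transpose A *v w) \<bullet> u) \<partial>tilted A \<mu> z)
      = partition_fun A \<mu> (z + w) / partition_fun A \<mu> z"
    by (subst integral_tilted[OF \<mu> X])
      (auto intro!: continuous_intros
        simp: partition_fun_def matrix_vector_right_distrib inner_add_left exp_add divide_inverse)
  then show ?thesis
    using partition_fun_pos[OF \<mu> X, of A]
    by (simp add: log_mgf_def ln_div less_imp_neq[symmetric] del: transpose_matrix_vector
        flip: partition_fun_def)
qed

text \<open>The gradient of a convex function is monotone: the increment of the cumulant function between
  the two points lies between the two inner products.\<close>

lemma tilted_mean_mono:
  assumes \<mu>: "\<mu> \<in> borel_probs X" and X: "compact X"
  shows "(transpose A *v w) \<bullet> (\<integral>u. u \<partial>tilted A \<mu> z)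
    \<le> (transpose A *v w) \<bullet> (\<integral>u. u \<partial>tilted A \<mu> (z + w))"
proof -
  have lb: "(transpose A *v v) \<bullet> (\<integral>u. u \<partial>tilted A \<mu> y)
      \<le> log_mgf \<mu> (transpose A *v (y + v)) - log_mgf \<mu> (transpose A *v y)" for v y
    using log_mgf_ge_mean(1)[OF tilted_in_borel_probs[OF \<mu> X] X] log_mgf_shift[OF \<mu> X]
    by (smt (verit))
  have "transpose A *v (- w) = - (transpose A *v w)"
    using matrix_vector_mult_diff_distrib[of "transpose A" 0 w] by simp
  then show ?thesis
    using lb[of w z] lb[of "- w" "z + w"] by simp
qed

section \<open>Stability of the dual minimizers\<close>

lemma dual_objective_real:
  assumes "fenchel_conjugate g (- (z /\<^sub>R \<alpha>)) = ereal P"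
  shows "dual_objective A b \<alpha> g \<mu> z
    = ereal (\<alpha> * P - b \<bullet> z + log_mgf \<mu> (transpose A *v z))"
  using assms by (simp add: dual_objective_def)

text \<open>The objective is finite at \<open>- \<alpha> \<nabla>g(0)\<close>, hence at every minimizer.\<close>

lemma dual_minimizer_in_domain:
  assumes "convex_on UNIV g" and "\<And>x. GDERIV g x :> grad x" and "\<alpha> > 0"
    and sol: "solves_dual A b \<alpha> g \<mu> z"
  obtains P where "fenchel_conjugate g (- (z /\<^sub>R \<alpha>)) = ereal P"
proof -
  let ?z = "- (\<alpha> *\<^sub>R grad 0)"
  have "fenchel_conjugate g (- (?z /\<^sub>R \<alpha>)) \<noteq> \<infinity>"
    using fenchel_conjugate_grad_finite[OF assms(1,2), of 0] \<open>\<alpha> > 0\<close> by simp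
  then obtain P where "fenchel_conjugate g (- (?z /\<^sub>R \<alpha>)) = ereal P"
    using fenchel_conjugate_not_MInf by (metis ereal_cases)
  then have "dual_objective A b \<alpha> g \<mu> ?z \<noteq> \<infinity>"
    by (simp add: dual_objective_real del: scaleR_minus_right)
  moreover have "dual_objective A b \<alpha> g \<mu> z \<le> dual_objective A b \<alpha> g \<mu> ?z"
    using sol by (auto simp: solves_dual_def is_arg_min_def not_less)
  ultimately have "dual_objective A b \<alpha> g \<mu> z \<noteq> \<infinity>"
    by auto
  then have "fenchel_conjugate g (- (z /\<^sub>R \<alpha>)) \<noteq> \<infinity>"
    using \<open>\<alpha> > 0\<close> by (auto simp: dual_objective_def)
  then show ?thesis
    using that fenchel_conjugate_not_MInf by (metis ereal_cases)
qed

text \<open>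
  Minimality of \<open>z\<close> is tested at the points \<open>z + t (y - z)\<close>.  The strong convexity of the conjugate
  term and the quadratic upper bound on the cumulant function give, after division by \<open>t\<close>, the
  claim up to an error of order \<open>t\<close>; then \<open>t\<close> tends to \<open>0\<close>.
\<close>

lemma dual_minimizer_variational:
  fixes A :: "real^'m^'d" and g :: "real^'d \<Rightarrow> real"
  assumes \<mu>: "\<mu> \<in> borel_probs X" and X: "compact X"
    and g: "\<And>x. GDERIV g x :> grad x" and L: "(1 / \<beta>)-lipschitz_on UNIV grad"
    and "\<alpha> > 0" "\<beta> > 0"
    and sol: "solves_dual A b \<alpha> g \<mu> z"
    and P: "fenchel_conjugate g (- (z /\<^sub>R \<alpha>)) = ereal P"
    and Q: "fenchel_conjugate g (- (y /\<^sub>R \<alpha>)) = ereal Q"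
  shows "\<alpha> * P + b \<bullet> (y - z) - (transpose A *v (y - z)) \<bullet> (\<integral>u. u \<partial>tilted A \<mu> z)
    + \<beta> / (2 * \<alpha>) * (norm (y - z))\<^sup>2 \<le> \<alpha> * Q"
proof -
  define D where "D = y - z"
  define E where "E = (transpose A *v D) \<bullet> (\<integral>u. u \<partial>tilted A \<mu> z)"
  define S where "S = \<beta> / (2 * \<alpha>) * (norm D)\<^sup>2"
  note tilt = tilted_in_borel_probs[OF \<mu> X, of A z]
  have "bounded ((\<lambda>u. (transpose A *v D) \<bullet> u) ` X)"
    using X by (intro compact_imp_bounded compact_continuous_image continuous_intros)
  then obtain K where K: "K > 0" "\<And>u. u \<in> X \<Longrightarrow> \<bar>(transpose A *v D) \<bullet> u\<bar> \<le> K"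
    by (auto simp: bounded_pos)
  have step: "\<alpha> * P + b \<bullet> D - E + (1 - t) * S \<le> \<alpha> * Q + t * K\<^sup>2"
    if t: "0 < t" "t \<le> 1" "t * K \<le> 1" for t
  proof -
    let ?z = "z + t *\<^sub>R D"
    define R where "R = (1 - t) * P + t * Q - t * (1 - t) * S / \<alpha>"
    have arg: "- (?z /\<^sub>R \<alpha>) = (1 - t) *\<^sub>R (- (z /\<^sub>R \<alpha>)) + t *\<^sub>R (- (y /\<^sub>R \<alpha>))"
      by (simp add: D_def algebra_simps)
    have "- (z /\<^sub>R \<alpha>) - - (y /\<^sub>R \<alpha>) = D /\<^sub>R \<alpha>"
      by (simp add: D_def scaleR_diff_right)
    then have R: "R = (1 - t) * P + t * Q
        - \<beta> / 2 * t * (1 - t) * (norm (- (z /\<^sub>R \<alpha>) - - (y /\<^sub>R \<alpha>)))\<^sup>2"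
      using \<open>\<alpha> > 0\<close> by (simp add: R_def S_def power2_eq_square divide_simps)
    have le: "fenchel_conjugate g (- (?z /\<^sub>R \<alpha>)) \<le> ereal R"
      unfolding arg R using t
      by (intro fenchel_conjugate_strongly_convex[OF g L \<open>\<beta> > 0\<close> _ _ P Q]) auto
    then obtain T where T: "fenchel_conjugate g (- (?z /\<^sub>R \<alpha>)) = ereal T"
      using fenchel_conjugate_not_MInf by (metis ereal_cases ereal_infty_less_eq(1) PInfty_neq_ereal(1))
    have "dual_objective A b \<alpha> g \<mu> z \<le> dual_objective A b \<alpha> g \<mu> ?z"
      using sol by (auto simp: solves_dual_def is_arg_min_def not_less)
    then have "\<alpha> * P - b \<bullet> z + log_mgf \<mu> (transpose A *v z)
        \<le> \<alpha> * T - b \<bullet> ?z + log_mgf \<mu> (transpose A *v ?z)"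
      unfolding dual_objective_real[OF P] dual_objective_real[OF T] by simp
    moreover have "log_mgf \<mu> (transpose A *v ?z)
        = log_mgf \<mu> (transpose A *v z) + log_mgf (tilted A \<mu> z) (t *\<^sub>R (transpose A *v D))"
      unfolding log_mgf_shift[OF \<mu> X] by (simp add: matrix_vector_mult_scaleR)
    moreover have "log_mgf (tilted A \<mu> z) (t *\<^sub>R (transpose A *v D)) \<le> t * E + (t * K)\<^sup>2"
      using log_mgf_le_mean_plus_square[OF tilt X, of "t *\<^sub>R (transpose A *v D)" "t * K"] K t
      by (simp add: E_def abs_mult)
    moreover have "\<alpha> * T \<le> \<alpha> * R"
      using le T \<open>\<alpha> > 0\<close> by simp
    moreover have "\<alpha> * R = \<alpha> * P + t * (\<alpha> * Q - \<alpha> * P - (1 - t) * S)"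
      using \<open>\<alpha> > 0\<close> by (simp add: R_def field_simps)
    moreover have "b \<bullet> ?z = b \<bullet> z + t * (b \<bullet> D)"
      by (simp add: inner_add_right)
    ultimately have "0 \<le> t * (\<alpha> * Q - \<alpha> * P - (1 - t) * S) - t * (b \<bullet> D) + t * E + (t * K)\<^sup>2"
      by linarith
    also have "\<dots> = t * (\<alpha> * Q - \<alpha> * P - (1 - t) * S - b \<bullet> D + E + t * K\<^sup>2)"
      by (simp add: algebra_simps power2_eq_square)
    finally show ?thesis
      using t by (simp add: zero_le_mult_iff)
  qed
  have "\<alpha> * P + b \<bullet> D - E + (1 - 0) * S \<le> \<alpha> * Q + 0 * K\<^sup>2"
  proof (rule tendsto_le)
    show "((\<lambda>t. \<alpha> * Q + t * K\<^sup>2) \<longlongrightarrow> \<alpha> * Q + 0 * K\<^sup>2) (at_right 0)"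
      by (intro tendsto_intros)
    show "((\<lambda>t. \<alpha> * P + b \<bullet> D - E + (1 - t) * S) \<longlongrightarrow> \<alpha> * P + b \<bullet> D - E + (1 - 0) * S) (at_right 0)"
      by (intro tendsto_intros)
    have "eventually (\<lambda>t. t \<in> {0<..<min 1 (1 / K)}) (at_right 0)"
      using K by (intro eventually_at_right_real) auto
    then show "eventually (\<lambda>t. \<alpha> * P + b \<bullet> D - E + (1 - t) * S \<le> \<alpha> * Q + t * K\<^sup>2) (at_right 0)"
      by (rule eventually_mono) (use K in \<open>auto intro!: step simp: pos_less_divide_eq\<close>)
  qed simp
  then show ?thesis by (simp add: D_def E_def S_def)
qed

text \<open>
  In the sum of the two variational inequalities the finite conjugate values \<open>P\<close>, \<open>Q\<close> and the
  linear term \<open>b\<close> cancel, and the two quadratic terms add up to the full modulus \<open>\<beta> / \<alpha>\<close>.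
  Monotonicity of the tilted mean is applied to \<open>\<rho>\<close> only, since the tilt of \<open>\<eta>\<close> already
  sits at the point \<open>y\<close>.
\<close>

lemma dual_minimizers_dist_le:
  fixes A :: "real^'m^'d" and g :: "real^'d \<Rightarrow> real"
  assumes X: "compact X" and "\<alpha> > 0" "\<beta> > 0" and conv: "convex_on UNIV g"
    and g: "\<And>x. GDERIV g x :> grad x" and L: "(1 / \<beta>)-lipschitz_on UNIV grad"
    and \<rho>: "\<rho> \<in> borel_probs X" and \<eta>: "\<eta> \<in> borel_probs X"
    and sol: "solves_dual A b \<alpha> g \<rho> x" "solves_dual A b \<alpha> g \<eta> y"
  shows "norm (y - x)
    \<le> \<alpha> / \<beta> * (onorm ((*v) A) * norm ((\<integral>u. u \<partial>tilted A \<rho> y) - (\<integral>u. u \<partial>tilted A \<eta> y)))"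
proof -
  define D where "D = y - x"
  define E where "E = (\<integral>u. u \<partial>tilted A \<rho> y) - (\<integral>u. u \<partial>tilted A \<eta> y)"
  obtain P where P: "fenchel_conjugate g (- (x /\<^sub>R \<alpha>)) = ereal P"
    using dual_minimizer_in_domain[OF conv g \<open>\<alpha> > 0\<close> sol(1)] .
  obtain Q where Q: "fenchel_conjugate g (- (y /\<^sub>R \<alpha>)) = ereal Q"
    using dual_minimizer_in_domain[OF conv g \<open>\<alpha> > 0\<close> sol(2)] .
  note var = dual_minimizer_variational[OF _ X g L \<open>\<alpha> > 0\<close> \<open>\<beta> > 0\<close>]
  have swap: "x - y = - D" "transpose A *v (- D) = - (transpose A *v D)"
    using matrix_vector_mult_diff_distrib[of "transpose A" 0 D] by (simp_all add: D_def)
  have "\<alpha> * P + b \<bullet> D - (transpose A *v D) \<bullet> (\<integral>u. u \<partial>tilted A \<rho> x)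
      + \<beta> / (2 * \<alpha>) * (norm D)\<^sup>2 \<le> \<alpha> * Q"
    using var[OF \<rho> sol(1) P Q] by (simp add: D_def)
  moreover have "\<alpha> * Q - b \<bullet> D + (transpose A *v D) \<bullet> (\<integral>u. u \<partial>tilted A \<eta> y)
      + \<beta> / (2 * \<alpha>) * (norm D)\<^sup>2 \<le> \<alpha> * P"
    using var[OF \<eta> sol(2) Q P] unfolding swap norm_minus_cancel inner_minus_left inner_minus_right by linarith
  moreover have "(transpose A *v D) \<bullet> (\<integral>u. u \<partial>tilted A \<rho> x)
      \<le> (transpose A *v D) \<bullet> (\<integral>u. u \<partial>tilted A \<rho> y)"
    using tilted_mean_mono[OF \<rho> X, of A D x] by (simp add: D_def)
  ultimately have "2 * (\<beta> / (2 * \<alpha>) * (norm D)\<^sup>2) \<le> (transpose A *v D) \<bullet> E"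
    unfolding E_def inner_diff_right by linarith
  then have "\<beta> / \<alpha> * (norm D)\<^sup>2 \<le> (transpose A *v D) \<bullet> E"
    by simp
  also have "\<dots> = D \<bullet> (A *v E)"
    by (simp add: transpose_matrix_vector dot_lmul_matrix)
  also have "\<dots> \<le> norm D * (onorm ((*v) A) * norm E)"
    by (intro order.trans[OF norm_cauchy_schwarz] mult_left_mono onorm) auto
  finally have "norm D * (\<beta> / \<alpha> * norm D) \<le> norm D * (onorm ((*v) A) * norm E)"
    by (simp add: power2_eq_square mult_ac)
  moreover have "0 \<le> onorm ((*v) A) * norm E"
    by (intro mult_nonneg_nonneg onorm_pos_le) auto
  ultimately have "\<beta> / \<alpha> * norm D \<le> onorm ((*v) A) * norm E"
    by (cases "D = 0") (auto intro: mult_left_le_imp_le[where c = "norm D"])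
  then show ?thesis
    using \<open>\<alpha> > 0\<close> \<open>\<beta> > 0\<close> by (simp add: D_def E_def field_simps)
qed

text \<open>Of the two symmetric ways to split the difference of quotients, this one matches the first
  entry of \<open>kappa_max\<close> and the second entry of \<open>zeta_max\<close>.\<close>

lemma tilted_mean_diff_le:
  fixes A :: "real^'m^'d" and B :: "real^'p^'q"
  assumes X: "compact X" and \<rho>: "\<rho> \<in> borel_probs X" and \<eta>: "\<eta> \<in> borel_probs X"
  shows "onorm ((*v) B) * norm ((\<integral>u. u \<partial>tilted A \<rho> z) - (\<integral>u. u \<partial>tilted A \<eta> z))
    \<le> kappa A B \<rho> \<eta> z * \<bar>diff_integral \<eta> \<rho> (\<lambda>u. exp ((transpose A *v z) \<bullet> u))\<bar>
      + zeta A B \<eta> z * norm (diff_integral \<rho> \<eta> (\<lambda>u. exp ((transpose A *v z) \<bullet> u) *\<^sub>R u))"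
proof -
  define Z where "Z \<mu> = partition_fun A \<mu> z" for \<mu>
  define N where "N \<mu> = (\<integral>u. exp ((transpose A *v z) \<bullet> u) *\<^sub>R u \<partial>\<mu>)" for \<mu>
  define E where "E = (\<integral>u. u \<partial>tilted A \<rho> z)"
  have Z: "Z \<rho> > 0" "Z \<eta> > 0"
    unfolding Z_def using partition_fun_pos[OF _ X] \<rho> \<eta> by auto
  have E: "E = N \<rho> /\<^sub>R Z \<rho>" "(\<integral>u. u \<partial>tilted A \<eta> z) = N \<eta> /\<^sub>R Z \<eta>"
    unfolding E_def N_def Z_def
    using integral_tilted[OF _ X, of _ "\<lambda>u. u"] \<rho> \<eta> by auto
  have "E - N \<eta> /\<^sub>R Z \<eta> = ((Z \<eta> - Z \<rho>) / Z \<eta>) *\<^sub>R E + (N \<rho> - N \<eta>) /\<^sub>R Z \<eta>"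
  proof -
    have "N \<rho> = Z \<rho> *\<^sub>R E"
      using E Z by simp
    then have "((Z \<eta> - Z \<rho>) / Z \<eta>) *\<^sub>R E + (N \<rho> - N \<eta>) /\<^sub>R Z \<eta>
        = (Z \<eta> / Z \<eta>) *\<^sub>R E - N \<eta> /\<^sub>R Z \<eta>"
      by (simp add: divide_inverse algebra_simps)
    then show ?thesis
      using Z by simp
  qed
  then have "norm (E - N \<eta> /\<^sub>R Z \<eta>)
      \<le> norm E * inverse (Z \<eta>) * \<bar>Z \<eta> - Z \<rho>\<bar> + inverse (Z \<eta>) * norm (N \<rho> - N \<eta>)"
    using norm_triangle_ineq[of "((Z \<eta> - Z \<rho>) / Z \<eta>) *\<^sub>R E" "(N \<rho> - N \<eta>) /\<^sub>R Z \<eta>"] Z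
    by (simp add: divide_inverse abs_mult mult_ac)
  then have "onorm ((*v) B) * norm (E - N \<eta> /\<^sub>R Z \<eta>)
      \<le> onorm ((*v) B) * (norm E * inverse (Z \<eta>) * \<bar>Z \<eta> - Z \<rho>\<bar>
          + inverse (Z \<eta>) * norm (N \<rho> - N \<eta>))"
    by (intro mult_left_mono onorm_pos_le) auto
  then show ?thesis
    unfolding E(2) kappa_def zeta_def diff_integral_def
    by (simp add: Z_def N_def E_def partition_fun_def distrib_left mult_ac)
qed

theorem corollary3p7:
  fixes X :: "(real^'m) set"
    and A :: "real^'m^'d"
    and b :: "real^'d"
    and \<alpha> \<beta> :: real
    and g :: "real^'d \<Rightarrow> real"
    and grad :: "real^'d \<Rightarrow> real^'d"
    and \<rho> \<eta> :: "(real^'m) measure"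
    and z\<^sub>\<rho> z\<^sub>\<eta> :: "real^'d"
  assumes "compact X"
    and "\<alpha> > 0" and "\<beta> > 0"
    and "convex_on UNIV g"
    and "\<And>x. GDERIV g x :> grad x"
    and "(1 / \<beta>)-lipschitz_on UNIV grad"
    and "\<rho> \<in> borel_probs X" and "\<eta> \<in> borel_probs X"
    and "solves_dual A b \<alpha> g \<rho> z\<^sub>\<rho>"
    and "solves_dual A b \<alpha> g \<eta> z\<^sub>\<eta>"
  shows "norm (z\<^sub>\<eta> - z\<^sub>\<rho>)
    \<le> \<alpha> / \<beta> * kappa_max A A \<rho> \<eta> z\<^sub>\<eta>
        * \<bar>diff_integral \<eta> \<rho> (\<lambda>u. exp ((transpose A *v z\<^sub>\<eta>) \<bullet> u))\<bar>
      + \<alpha> / \<beta> * zeta_max A A \<rho> \<eta> z\<^sub>\<eta>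
        * norm (diff_integral \<rho> \<eta> (\<lambda>u. exp ((transpose A *v z\<^sub>\<eta>) \<bullet> u) *\<^sub>R u))"
proof -
  let ?d = "\<bar>diff_integral \<eta> \<rho> (\<lambda>u. exp ((transpose A *v z\<^sub>\<eta>) \<bullet> u))\<bar>"
  let ?n = "norm (diff_integral \<rho> \<eta> (\<lambda>u. exp ((transpose A *v z\<^sub>\<eta>) \<bullet> u) *\<^sub>R u))"
  have "norm (z\<^sub>\<eta> - z\<^sub>\<rho>) \<le> \<alpha> / \<beta> * (onorm ((*v) A)
      * norm ((\<integral>u. u \<partial>tilted A \<rho> z\<^sub>\<eta>) - (\<integral>u. u \<partial>tilted A \<eta> z\<^sub>\<eta>)))"
    by (rule dual_minimizers_dist_le[OF assms])
  also have "\<dots> \<le> \<alpha> / \<beta> * (kappa A A \<rho> \<eta> z\<^sub>\<eta> * ?d + zeta A A \<eta> z\<^sub>\<eta> * ?n)"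
    using assms(2,3) by (intro mult_left_mono tilted_mean_diff_le[OF assms(1,7,8)]) auto
  also have "\<dots> \<le> \<alpha> / \<beta> * (kappa_max A A \<rho> \<eta> z\<^sub>\<eta> * ?d + zeta_max A A \<rho> \<eta> z\<^sub>\<eta> * ?n)"
    using assms(2,3) unfolding kappa_max_def zeta_max_def
    by (intro mult_left_mono add_mono mult_right_mono) auto
  finally show ?thesis
    by (simp add: distrib_left mult.assoc)
qed

end
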